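(* Define sequences $(x_i)_{i\ge1}$, $(b_i)_{i\ge1}$, $(l_i)_{i\ge1}$ by: for $1\le i\le 5$, $x_i=(0,1)$, $b_i=2$, $l_i=0$; for $i\ge 6$, $x_i=P_{i,i^2}$, $b_i=2^i$, $l_i=2^{4i^2}$. Let $Q=(q_n)$ and $x$ be the basic sequence and real number associated with $(l_i),(b_i),(x_i)$ as described in the context. Then $x$ is $Q$-normal.
   Context: A block of length $k$ is a $k$-tuple of non-negative integers; $|B|$ denotes the length of a block $B$. For a positive integer $b$, define the weighting $\nu_b$ on digits by $\nu_b(j)=2^{-b}$ for $0\le j\le b-1$, $\nu_b(b)=(2^b-b)/2^b$, $\nu_b(j)=0$ for $j>b$, and for a block $B=(c_1,\dots,c_k)$ set $\nu_b(B)=\prod_{j=1}^k\nu_b(c_j)$. For positive integers $b,w$, let $P_1,P_2,\dots,P_{(b+1)^w}$ be all blocks of length $w$ with digits in $\{0,1,\dots,b\}$, listed in lexicographic order, and let $P_{b,w}$ be the block obtained by concatenating $2^{bw}\nu_b(P_1)$ copies of $P_1$, then $2^{bw}\nu_b(P_2)$ copies of $P_2$, and so on up to $P_{(b+1)^w}$ (these multiplicities equal $(2^b-b)^{g}$ where $g$ is the number of digits equal to $b$ in the block, hence are integers). Associated $Q$ and $x$: given sequences of non-negative integers $(l_i)$, $(b_i)$ with $b_i\ge2$ and blocks $(x_i)$, put $L_0=0$, $L_i=\sum_{j=1}^i l_j|x_j|$, $q_n=b_i$ for $L_{i-1}<n\le L_i$, $Q=(q_n)_{n\ge1}$; let $(E_1,E_2,\dots)$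 be the infinite digit sequence formed by concatenating $l_1$ copies of $x_1$, then $l_2$ copies of $x_2$, then $l_3$ copies of $x_3$, etc.; and set $x=\sum_{n\ge1}E_n/(q_1q_2\cdots q_n)$. A basic sequence is a sequence $Q=(q_n)$ of integers $q_n\ge2$. The $Q$-Cantor series expansion of $x\in[0,1)$ is the unique expansion $x=\sum_{n\ge1}E_n/(q_1\cdots q_n)$ with $E_n\in\{0,\dots,q_n-1\}$ and $E_n\ne q_n-1$ infinitely often. $N_n^Q(B,x)$ denotes the number of positions $s\le n$ at which the block $B$ occurs (starting at position $s$) in the digit sequence $(E_n)$ of the $Q$-Cantor expansion of $x$. Set $Q_n^{(k)}=\sum_{j=1}^n \frac{1}{q_jq_{j+1}\cdots q_{j+k-1}}$. The number $x$ is $Q$-normal if for every $k\ge1$ and every block $B$ of length $k$, $\lim_{n\to\infty}N_n^Q(B,x)/Q_n^{(k)}=1$. *)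

theory Defs
  imports Complex_Main
begin

text \<open>
  Blocks are lists of natural numbers. All sequences indexed from 1 in the mathematics are
  functions on \<^typ>\<open>nat\<close> whose value at 0 is irrelevant.
\<close>

type_synonym block = "nat list"

definition nu :: "nat \<Rightarrow> nat \<Rightarrow> real" where
  "nu b j = (if j < b then 1 / 2 ^ b else if j = b then (2 ^ b - real b) / 2 ^ b else 0)"

definition nu_block :: "nat \<Rightarrow> block \<Rightarrow> real" where
  "nu_block b B = (\<Prod>j<length B. nu b (B ! j))"

text \<open>\<^const>\<open>product_lists\<close> varies the last coordinate fastest, which is the lexicographic order.\<close>

definition lex_blocks :: "nat \<Rightarrow> nat \<Rightarrow> block list" where
  "lex_blocks b w = product_lists (replicate w [0..<Suc b])"

lemma set_lex_blocks: "set (lex_blocks b w) = {B. length B = w \<and> set B \<subseteq> {0..b}}"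
proof (induction w)
  case 0
  show ?case by (auto simp: lex_blocks_def)
next
  case (Suc w)
  have "set (lex_blocks b (Suc w)) = {c # B |c B. c \<le> b \<and> B \<in> set (lex_blocks b w)}"
    by (auto simp: lex_blocks_def image_iff Bex_def less_Suc_eq_le simp del: upt_Suc)
  also have "\<dots> = {B. length B = Suc w \<and> set B \<subseteq> {0..b}}"
    unfolding Suc by (auto simp: length_Suc_conv)
  finally show ?case .
qed

lemma sorted_lex_blocks:
  "sorted_wrt (\<lambda>A B. (A, B) \<in> lexord {(c, d). c < d}) (lex_blocks b w)"
proof (induction w)
  case 0
  show ?case by (simp add: lex_blocks_def)
next
  case (Suc w)
  let ?R = "\<lambda>A B. (A, B) \<in> lexord {(c::nat, d). c < d}"
  have "sorted_wrt ?R (concat (map (\<lambda>c. map (Cons c) Bs) cs))"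
    if "sorted_wrt (<) cs" "sorted_wrt ?R Bs" for cs Bs
    using that(1)
  proof (induction cs)
    case (Cons c cs)
    have "sorted_wrt ?R (map (Cons c) Bs)"
      using that(2) by (auto simp: sorted_wrt_map elim!: sorted_wrt_mono_rel[rotated])
    with Cons show ?case by (auto simp: sorted_wrt_append)
  qed simp
  from this[OF _ Suc] show ?case
    by (simp add: lex_blocks_def del: upt_Suc)
qed

definition multiplicity_nu :: "nat \<Rightarrow> nat \<Rightarrow> block \<Rightarrow> nat" where
  "multiplicity_nu b w B = nat \<lfloor>2 ^ (b * w) * nu_block b B\<rfloor>"

text \<open>The floor above only converts an integral real to a natural number.\<close>

lemma nu_block_scaled:
  assumes "set B \<subseteq> {0..b}"
  shows "2 ^ (b * length B) * nu_block b B = real ((2 ^ b - b) ^ count_list B b)"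
  using assms
proof (induction B)
  case Nil
  show ?case by (simp add: nu_block_def)
next
  case (Cons c B)
  have le: "b \<le> 2 ^ b" by (simp add: less_imp_le)
  have "nu_block b (c # B) = nu b c * nu_block b B"
    by (simp add: nu_block_def prod.lessThan_Suc_shift del: prod.lessThan_Suc)
  then have "2 ^ (b * length (c # B)) * nu_block b (c # B) =
      (2 ^ b * nu b c) * (2 ^ (b * length B) * nu_block b B)"
    by (simp add: power_add)
  also have "\<dots> = (2 ^ b * nu b c) * real ((2 ^ b - b) ^ count_list B b)"
    using Cons by simp
  also have "2 ^ b * nu b c = (if c = b then real (2 ^ b - b) else 1)"
    using Cons.prems le by (auto simp: nu_def of_nat_diff)
  finally show ?case by auto
qed

lemma real_multiplicity_nu:
  assumes "B \<in> set (lex_blocks b w)"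
  shows "real (multiplicity_nu b w B) = 2 ^ (b * w) * nu_block b B"
proof -
  have "length B = w" "set B \<subseteq> {0..b}" using assms by (auto simp: set_lex_blocks)
  then show ?thesis
    using nu_block_scaled[of B b] unfolding multiplicity_nu_def by (simp only: floor_of_nat nat_int)
qed

definition P_block :: "nat \<Rightarrow> nat \<Rightarrow> block" where
  "P_block b w =
     concat (map (\<lambda>B. concat (replicate (multiplicity_nu b w B) B)) (lex_blocks b w))"

definition assoc_L :: "(nat \<Rightarrow> nat) \<Rightarrow> (nat \<Rightarrow> block) \<Rightarrow> nat \<Rightarrow> nat" where
  "assoc_L l X i = (\<Sum>j=1..i. l j * length (X j))"

definition assoc_index :: "(nat \<Rightarrow> nat) \<Rightarrow> (nat \<Rightarrow> block) \<Rightarrow> nat \<Rightarrow> nat" where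
  "assoc_index l X n = (THE i. 1 \<le> i \<and> assoc_L l X (i - 1) < n \<and> n \<le> assoc_L l X i)"

definition assoc_Q :: "(nat \<Rightarrow> nat) \<Rightarrow> (nat \<Rightarrow> nat) \<Rightarrow> (nat \<Rightarrow> block) \<Rightarrow> nat \<Rightarrow> nat" where
  "assoc_Q l b X n = b (assoc_index l X n)"

definition assoc_prefix :: "(nat \<Rightarrow> nat) \<Rightarrow> (nat \<Rightarrow> block) \<Rightarrow> nat \<Rightarrow> block" where
  "assoc_prefix l X i = concat (map (\<lambda>j. concat (replicate (l j) (X j))) [1..<Suc i])"

text \<open>
  The \<open>n\<close>-th digit of the infinite concatenation is read off from the finite concatenation of
  the first \<open>i\<close> groups, where \<open>i\<close> is the group containing position \<open>n\<close>.
\<close>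

definition assoc_E :: "(nat \<Rightarrow> nat) \<Rightarrow> (nat \<Rightarrow> block) \<Rightarrow> nat \<Rightarrow> nat" where
  "assoc_E l X n = assoc_prefix l X (assoc_index l X n) ! (n - 1)"

definition assoc_x :: "(nat \<Rightarrow> nat) \<Rightarrow> (nat \<Rightarrow> nat) \<Rightarrow> (nat \<Rightarrow> block) \<Rightarrow> real" where
  "assoc_x l b X =
     (\<Sum>n. real (assoc_E l X (Suc n)) / real (\<Prod>j=1..Suc n. assoc_Q l b X j))"

definition basic_sequence :: "(nat \<Rightarrow> nat) \<Rightarrow> bool" where
  "basic_sequence q \<longleftrightarrow> (\<forall>n\<ge>1. 2 \<le> q n)"

definition cantor_expansion :: "(nat \<Rightarrow> nat) \<Rightarrow> real \<Rightarrow> (nat \<Rightarrow> nat) \<Rightarrow> bool" where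
  "cantor_expansion q x E \<longleftrightarrow>
     (\<forall>n\<ge>1. E n \<le> q n - 1) \<and>
     infinite {n. 1 \<le> n \<and> E n \<noteq> q n - 1} \<and>
     (\<lambda>n. real (E (Suc n)) / real (\<Prod>j=1..Suc n. q j)) sums x"

text \<open>The condition at 0 makes the digit function unique despite the unused index 0.\<close>

definition cantor_digits :: "(nat \<Rightarrow> nat) \<Rightarrow> real \<Rightarrow> nat \<Rightarrow> nat" where
  "cantor_digits q x = (THE E. E 0 = 0 \<and> cantor_expansion q x E)"

definition block_count :: "(nat \<Rightarrow> nat) \<Rightarrow> nat \<Rightarrow> block \<Rightarrow> real \<Rightarrow> nat" where
  "block_count q n B x =
     card {s \<in> {1..n}. \<forall>j<length B. cantor_digits q x (s + j) = B ! j}"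

definition Q_sum :: "(nat \<Rightarrow> nat) \<Rightarrow> nat \<Rightarrow> nat \<Rightarrow> real" where
  "Q_sum q k n = (\<Sum>j=1..n. 1 / real (\<Prod>i<k. q (j + i)))"

definition Q_normal :: "(nat \<Rightarrow> nat) \<Rightarrow> real \<Rightarrow> bool" where
  "Q_normal q x \<longleftrightarrow>
     basic_sequence q \<and> 0 \<le> x \<and> x < 1 \<and>
     (\<forall>k\<ge>1. \<forall>B. length B = k \<longrightarrow>
        (\<lambda>n. real (block_count q n B x) / Q_sum q k n) \<longlonglongrightarrow> 1)"

end

theory Submission imports Defs begin

text \<open>
  Cut \<open>P_block b w\<close> into its \<open>2^(b w)\<close> words of length \<open>w\<close>. A word is almost always followed by a copy
  of itself, so occurrences of a block \<open>B\<close> of length \<open>k\<close> can be counted cyclically inside words.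
  For digits of \<open>B\<close> below \<open>b\<close>, the product structure of the weights makes the cyclic count exactly
  \<open>w 2^(b (w - k))\<close>, and it is wrong only at words followed by a different word, of which there
  are at most \<open>(b + 1)^w\<close>. With \<open>b = i\<close>, \<open>w = i\<^sup>2\<close> and bases \<open>2^i\<close> this matches, up to a factor
  \<open>1 + O(2^-i)\<close>, the increment of the normalising sum over one copy of the \<open>i\<close>-th block.
  The choice of \<open>l i\<close> makes one copy of block \<open>i + 1\<close> negligible against everything before it, so
  the comparison at the ends of copies extends to all \<open>n\<close>.
\<close>

section \<open>Uniqueness of Cantor series expansions\<close>

text \<open>With all digits maximal the sum telescopes: the digit \<open>q n - 1\<close> contributes
  the difference between the reciprocals of the products of the first \<open>n - 1\<close> and the
  first \<open>n\<close> bases.\<close>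

lemma cantor_partial_sum_le:
  assumes q: "basic_sequence q" and E: "\<And>n. 1 \<le> n \<Longrightarrow> E n \<le> q n - 1"
  shows "(\<Sum>n<N. real (E (Suc n)) / real (\<Prod>j=1..Suc n. q j)) \<le> 1 - 1 / real (\<Prod>j=1..N. q j)"
proof (induction N)
  case (Suc N)
  define P where "P = real (\<Prod>j=1..N. q j)"
  have qpos: "q j \<ge> 2" if "j \<ge> 1" for j using q that by (simp add: basic_sequence_def)
  have P: "P > 0" unfolding P_def of_nat_0_less_iff
    by (rule prod_pos) (use qpos in \<open>fastforce dest: spec\<close>)
  have Q: "real (q (Suc N)) \<ge> 2" using qpos[of "Suc N"] by linarith
  have "E (Suc N) + 1 \<le> q (Suc N)" using E[of "Suc N"] qpos[of "Suc N"] by linarith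
  then have "real (E (Suc N)) \<le> real (q (Suc N)) - 1" by linarith
  then have "real (E (Suc N)) / (P * q (Suc N)) \<le> (real (q (Suc N)) - 1) / (P * q (Suc N))"
    using P Q by (intro divide_right_mono) auto
  also have "\<dots> = 1 / P - 1 / (P * q (Suc N))" using P Q by (simp add: field_simps)
  finally show ?case using Suc by (simp add: P_def)
qed simp

text \<open>Raising the non-maximal digit at \<open>m\<close> by one keeps all digits admissible, so
  the previous bound still applies to the larger sum. The gain does not depend on \<open>N\<close>,
  hence it survives the limit and separates \<open>x\<close> from 1.\<close>

lemma cantor_partial_sum_strict:
  assumes q: "basic_sequence q" and E: "\<And>n. 1 \<le> n \<Longrightarrow> E n \<le> q n - 1"
    and m: "1 \<le> m" "E m \<noteq> q m - 1" and N: "m \<le> N"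
  shows "(\<Sum>n<N. real (E (Suc n)) / real (\<Prod>j=1..Suc n. q j))
    \<le> 1 - 1 / real (\<Prod>j=1..m. q j)"
proof -
  have "(\<Sum>n<N. real (E (Suc n)) / real (\<Prod>j=1..Suc n. q j)) + 1 / real (\<Prod>j=1..m. q j)
     = (\<Sum>n<N. real ((E(m := Suc (E m))) (Suc n)) / real (\<Prod>j=1..Suc n. q j))"
  proof -
    have "(\<Sum>n<N. real ((E(m := Suc (E m))) (Suc n)) / real (\<Prod>j=1..Suc n. q j))
      = (\<Sum>n<N. real (E (Suc n)) / real (\<Prod>j=1..Suc n. q j)
          + (if n = m - 1 then 1 / real (\<Prod>j=1..m. q j) else 0))"
      using m by (intro sum.cong) (auto simp: add_divide_distrib)
    then show ?thesis using m N by (simp add: sum.distrib)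
  qed
  also have "\<dots> \<le> 1 - 1 / real (\<Prod>j=1..N. q j)"
  proof (rule cantor_partial_sum_le[OF q])
    fix n :: nat assume "1 \<le> n"
    then show "(E(m := Suc (E m))) n \<le> q n - 1"
      using E[of n] m by auto
  qed
  also have "\<dots> \<le> 1" by (simp add: prod_nonneg)
  finally show ?thesis by simp
qed

lemma cantor_expansion_bounds:
  assumes q: "basic_sequence q" and x: "cantor_expansion q x E"
  shows "0 \<le> x" "x < 1"
proof -
  let ?a = "\<lambda>n. real (E (Suc n)) / real (\<Prod>j=1..Suc n. q j)"
  have s: "?a sums x" and E: "\<And>n. 1 \<le> n \<Longrightarrow> E n \<le> q n - 1"
    and inf: "infinite {n. 1 \<le> n \<and> E n \<noteq> q n - 1}"
    using x by (auto simp: cantor_expansion_def)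
  show "0 \<le> x" by (rule sums_le[OF _ sums_zero s]) (simp add: prod_nonneg)
  obtain m where m: "1 \<le> m" "E m \<noteq> q m - 1"
    using infinite_imp_nonempty[OF inf] by auto
  have "x \<le> 1 - 1 / real (\<Prod>j=1..m. q j)"
    using s unfolding sums_def
    by (rule LIMSEQ_le_const2) (use cantor_partial_sum_strict[OF q E m] in blast)
  moreover have "(\<Prod>j=1..m. q j) > 0"
    by (rule prod_pos) (use q in \<open>fastforce simp: basic_sequence_def\<close>)
  ultimately show "x < 1" by (smt (verit) of_nat_0_less_iff zero_less_divide_1_iff)
qed

text \<open>Multiplying by \<open>q 1\<close> and dropping the first digit turns an expansion into
  one for the shifted bases. This drives the induction for uniqueness.\<close>

lemma cantor_expansion_shift:
  assumes q: "basic_sequence q" and x: "cantor_expansion q x E"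
  shows "cantor_expansion (\<lambda>n. q (Suc n)) (x * real (q 1) - real (E 1)) (\<lambda>n. E (Suc n))"
  unfolding cantor_expansion_def
proof (intro conjI allI impI)
  show "E (Suc n) \<le> q (Suc n) - 1" for n using x by (auto simp: cantor_expansion_def)
  have inf: "infinite {n. 1 \<le> n \<and> E n \<noteq> q n - 1}" using x by (auto simp: cantor_expansion_def)
  have "{n. 1 \<le> n \<and> E n \<noteq> q n - 1} \<subseteq> {0,1} \<union> Suc ` {n. 1 \<le> n \<and> E (Suc n) \<noteq> q (Suc n) - 1}"
  proof
    fix n assume "n \<in> {n. 1 \<le> n \<and> E n \<noteq> q n - 1}"
    then show "n \<in> {0,1} \<union> Suc ` {n. 1 \<le> n \<and> E (Suc n) \<noteq> q (Suc n) - 1}"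
      by (cases n; cases "n = 1") auto
  qed
  then show "infinite {n. 1 \<le> n \<and> E (Suc n) \<noteq> q (Suc n) - 1}"
    using inf finite_subset by blast
  have q1: "real (q 1) \<noteq> 0" using q by (fastforce simp: basic_sequence_def)
  let ?a = "\<lambda>n. real (E (Suc n)) / real (\<Prod>j=1..Suc n. q j)"
  have "?a sums x" using x by (auto simp: cantor_expansion_def)
  then have "(\<lambda>n. ?a (Suc n)) sums (x - ?a 0)" by (subst sums_Suc_iff) simp
  then have "(\<lambda>n. q 1 * ?a (Suc n)) sums (q 1 * (x - ?a 0))" by (rule sums_mult)
  moreover have "q 1 * (x - ?a 0) = x * real (q 1) - real (E 1)" using q1 by (simp add: field_simps)
  moreover have "q 1 * ?a (Suc n) = real (E (Suc (Suc n))) / real (\<Prod>j=1..Suc n. q (Suc j))" for n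
  proof -
    have "(\<Prod>j=1..Suc (Suc n). q j) = q 1 * (\<Prod>j=1..Suc n. q (Suc j))"
      using prod.atLeast_Suc_atMost[of 1 "Suc (Suc n)" q] prod.shift_bounds_cl_Suc_ivl[of q 1 "Suc n"]
      by (simp del: prod.cl_ivl_Suc)
    then show ?thesis using q1 by (simp del: prod.cl_ivl_Suc)
  qed
  ultimately show "(\<lambda>n. real (E (Suc (Suc n))) / real (\<Prod>j=1..Suc n. q (Suc j))) sums
      (x * real (q 1) - real (E 1))" by (simp del: prod.cl_ivl_Suc)
qed

text \<open>The shifted number \<open>x * q 1 - E 1\<close> has an expansion of its own and so lies
  in [0,1), which makes \<open>E 1\<close> the integer part.\<close>

lemma cantor_expansion_first_digit:
  assumes q: "basic_sequence q" and x: "cantor_expansion q x E"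
  shows "int (E 1) = \<lfloor>x * real (q 1)\<rfloor>"
proof -
  have "basic_sequence (\<lambda>n. q (Suc n))" using q by (simp add: basic_sequence_def)
  from cantor_expansion_bounds[OF this cantor_expansion_shift[OF q x]]
  show ?thesis by linarith
qed

lemma cantor_expansion_unique:
  assumes "basic_sequence q" "cantor_expansion q x E" "cantor_expansion q x F"
  shows "E (Suc n) = F (Suc n)"
  using assms
proof (induction n arbitrary: q x E F)
  case 0
  then show ?case
    using cantor_expansion_first_digit[of q x E] cantor_expansion_first_digit[of q x F] by simp
next
  case (Suc n)
  have "E 1 = F 1"
    using cantor_expansion_first_digit[of q x E] cantor_expansion_first_digit[of q x F] Suc.prems
    by simp
  moreover have "basic_sequence (\<lambda>n. q (Suc n))" using Suc.prems by (simp add: basic_sequence_def)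
  ultimately show ?case
    using Suc.IH[of "\<lambda>n. q (Suc n)" "x * real (q 1) - real (E 1)" "\<lambda>n. E (Suc n)" "\<lambda>n. F (Suc n)"]
      cantor_expansion_shift[of q x E] cantor_expansion_shift[of q x F] Suc.prems by simp
qed

lemma cantor_digits_eq:
  assumes q: "basic_sequence q" and x: "cantor_expansion q x E" and n: "1 \<le> n"
  shows "cantor_digits q x n = E n"
proof -
  \<comment> \<open>The value at index 0 does not affect being an expansion, so it can be reset to
    the 0 that \<open>cantor_digits\<close> prescribes.\<close>
  have eq: "cantor_expansion q x F \<longleftrightarrow> cantor_expansion q x (F(0 := 0))" for F
  proof -
    have "{n. 1 \<le> n \<and> (F(0 := 0)) n \<noteq> q n - 1} = {n. 1 \<le> n \<and> F n \<noteq> q n - 1}" by auto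
    then show ?thesis by (simp add: cantor_expansion_def)
  qed
  have "cantor_digits q x = E(0 := 0)"
    unfolding cantor_digits_def
  proof (rule the_equality)
    show "(E(0 := 0)) 0 = 0 \<and> cantor_expansion q x (E(0 := 0))" using x eq[of E] by simp
    fix F assume F: "F 0 = 0 \<and> cantor_expansion q x F"
    show "F = E(0 := 0)"
    proof
      fix n show "F n = (E(0 := 0)) n"
        using cantor_expansion_unique[OF q x, of F "n - 1"] F by (cases n) auto
    qed
  qed
  then show ?thesis using n by simp
qed

text \<open>No digit is maximal, so the condition on infinitely many digits is immediate; the series
  has nonnegative terms and partial sums at most 1, so it converges.\<close>

lemma cantor_expansion_suminf:
  assumes q: "basic_sequence q" and E: "\<And>n. 1 \<le> n \<Longrightarrow> E n < q n - 1"
  shows "cantor_expansion q (\<Sum>n. real (E (Suc n)) / real (\<Prod>j=1..Suc n. q j)) E"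
  unfolding cantor_expansion_def
proof (intro conjI allI impI)
  show "E n \<le> q n - 1" if "1 \<le> n" for n using E[OF that] by simp
  have "{n. 1 \<le> n \<and> E n \<noteq> q n - 1} = {1..}" using E by force
  then show "infinite {n. 1 \<le> n \<and> E n \<noteq> q n - 1}" by (simp add: infinite_Ici)
  show "(\<lambda>n. real (E (Suc n)) / real (\<Prod>j=1..Suc n. q j)) sums
      (\<Sum>n. real (E (Suc n)) / real (\<Prod>j=1..Suc n. q j))"
  proof (rule summable_sums, rule summableI_nonneg_bounded)
    fix N
    have "(\<Sum>n<N. real (E (Suc n)) / real (\<Prod>j=1..Suc n. q j)) \<le> 1 - 1 / real (\<Prod>j=1..N. q j)"
      using E by (intro cantor_partial_sum_le[OF q]) (simp add: less_imp_le)
    also have "\<dots> \<le> 1" by (simp add: prod_nonneg)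
    finally show "(\<Sum>n<N. real (E (Suc n)) / real (\<Prod>j=1..Suc n. q j)) \<le> 1" .
  qed (simp add: prod_nonneg)
qed

section \<open>Occurrences of a block in \<open>P_block b w\<close>\<close>

lemma concat_uniform:
  assumes "\<forall>A\<in>set D. length A = w"
  shows "length (concat D) = length D * w"
    and "d < length D \<Longrightarrow> r < w \<Longrightarrow> concat D ! (d * w + r) = D ! d ! r"
proof -
  show "length (concat D) = length D * w"
    using assms by (induction D) auto
  show "d < length D \<Longrightarrow> r < w \<Longrightarrow> concat D ! (d * w + r) = D ! d ! r"
    using assms
  proof (induction D arbitrary: d)
    case (Cons A D)
    then show ?case by (cases d) (auto simp: nth_append)
  qed simp
qed

text \<open>Distributivity: expanding the product picks one letter for each place. It makes weighted
  counts of words factor over the places.\<close>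

lemma sum_lists_prod:
  fixes f :: "nat \<Rightarrow> 'a \<Rightarrow> 'b::comm_semiring_1"
  assumes "finite S"
  shows "(\<Sum>A | length A = w \<and> set A \<subseteq> S. \<Prod>t<w. f t (A ! t)) = (\<Prod>t<w. \<Sum>c\<in>S. f t c)"
proof (induction w arbitrary: f)
  case 0
  have "{A. length A = 0 \<and> set A \<subseteq> S} = {[]}" by auto
  then show ?case by simp
next
  case (Suc w)
  let ?W = "{A. length A = w \<and> set A \<subseteq> S}"
  have set_eq: "{A. length A = Suc w \<and> set A \<subseteq> S} = (\<lambda>(c, A). c # A) ` (S \<times> ?W)"
    by (auto simp: length_Suc_conv image_iff)
  have "(\<Sum>A | length A = Suc w \<and> set A \<subseteq> S. \<Prod>t<Suc w. f t (A ! t))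
      = (\<Sum>(c, A)\<in>S \<times> ?W. f 0 c * (\<Prod>t<w. f (Suc t) (A ! t)))"
    unfolding set_eq
    by (subst sum.reindex)
      (auto simp: inj_on_def prod.lessThan_Suc_shift simp del: prod.lessThan_Suc intro!: sum.cong)
  also have "\<dots> = (\<Sum>c\<in>S. f 0 c) * (\<Sum>A\<in>?W. \<Prod>t<w. f (Suc t) (A ! t))"
    by (simp add: sum_product sum.cartesian_product)
  also have "\<dots> = (\<Prod>t<Suc w. \<Sum>c\<in>S. f t c)"
    unfolding Suc[of "\<lambda>t. f (Suc t)"] by (simp add: prod.lessThan_Suc_shift del: prod.lessThan_Suc)
  finally show ?case .
qed

lemma multiplicity_nu_eq_prod:
  assumes "A \<in> set (lex_blocks b w)"
  shows "multiplicity_nu b w A = (\<Prod>t<w. if A ! t = b then 2 ^ b - b else 1)"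
proof -
  have A: "length A = w" "set A \<subseteq> {0..b}" using assms by (auto simp: set_lex_blocks)
  have "(\<Prod>t<length A. if A ! t = b then 2 ^ b - b else 1) = (2 ^ b - b) ^ count_list A b"
    by (induction A) (simp_all add: prod.lessThan_Suc_shift del: prod.lessThan_Suc)
  moreover have "real (multiplicity_nu b w A) = real ((2 ^ b - b) ^ count_list A b)"
    using real_multiplicity_nu[OF assms] nu_block_scaled[OF A(2)] A(1) by simp
  ultimately show ?thesis using A(1) by (metis of_nat_eq_iff)
qed

text \<open>Wrapping around models an occurrence that starts inside a word and runs on into a second
  copy of the same word.\<close>

definition cyclic_occ :: "block \<Rightarrow> nat \<Rightarrow> block \<Rightarrow> bool" where
  "cyclic_occ B r A \<longleftrightarrow> (\<forall>j<length B. A ! ((r + j) mod length A) = B ! j)"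

text \<open>The multiplicity is a product over places, with factor \<open>2 ^ b - b\<close> for the
  digit \<open>b\<close> and 1 for smaller digits. An occurrence fixes \<open>length B\<close>
  distinct places to digits below \<open>b\<close>, each with factor 1; every other place is free
  and contributes \<open>b + (2 ^ b - b) = 2 ^ b\<close>.\<close>

lemma sum_multiplicity_cyclic_occ:
  assumes k: "length B \<le> w" and B: "set B \<subseteq> {..<b}"
  shows "(\<Sum>A\<in>set (lex_blocks b w). multiplicity_nu b w A * of_bool (cyclic_occ B r A))
    = 2 ^ (b * (w - length B))"
proof -
  let ?k = "length B"
  define h where "h j = (r + j) mod w" for j
  \<comment> \<open>The weight of letter \<open>c\<close> at place \<open>t\<close>, set to 0 if it
    contradicts the occurrence of \<open>B\<close>.\<close>
  define f :: "nat \<Rightarrow> nat \<Rightarrow> nat" where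
    "f t c = (if c = b then 2 ^ b - b else 1) * of_bool (\<forall>j<?k. h j = t \<longrightarrow> c = B ! j)" for t c
  have inj: "inj_on h {..<?k}"
  proof (rule inj_onI)
    fix i j assume ij: "i \<in> {..<?k}" "j \<in> {..<?k}" "h i = h j"
    show "i = j"
    proof (rule ccontr)
      assume "i \<noteq> j"
      \<comment> \<open>Two colliding places would come from offsets differing by a positive
        multiple of \<open>w\<close>, but the difference is less than \<open>length B\<close>, which
        is at most \<open>w\<close>.\<close>
      have *: False if "i < j" "j < ?k" "h i = h j" for i j
      proof -
        have "w dvd (r + j) - (r + i)"
          using that mod_eq_dvd_iff_nat[of "r + i" "r + j" w] by (simp add: h_def)
        then have "w \<le> j - i" using that by (simp add: dvd_imp_le)
        then show False using that k by linarith
      qed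
      then show False using \<open>i \<noteq> j\<close> ij *[of i j] *[of j i] by (cases i j rule: linorder_cases) auto
    qed
  qed
  have hw: "h j < w" if "j < ?k" for j using that k by (simp add: h_def)
  have "(\<Sum>A\<in>set (lex_blocks b w). multiplicity_nu b w A * of_bool (cyclic_occ B r A))
      = (\<Sum>A | length A = w \<and> set A \<subseteq> {0..b}. \<Prod>t<w. f t (A ! t))"
    unfolding set_lex_blocks[symmetric]
  proof (rule sum.cong[OF refl])
    fix A assume A: "A \<in> set (lex_blocks b w)"
    then have "length A = w" by (simp add: set_lex_blocks)
    have "(\<Prod>t<w. of_bool (\<forall>j<?k. h j = t \<longrightarrow> A ! t = B ! j) :: nat)
        = of_bool (\<forall>t<w. \<forall>j<?k. h j = t \<longrightarrow> A ! t = B ! j)"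
      by (auto simp: of_bool_def)
    also have "(\<forall>t<w. \<forall>j<?k. h j = t \<longrightarrow> A ! t = B ! j) \<longleftrightarrow> cyclic_occ B r A"
      using hw \<open>length A = w\<close> by (auto simp: cyclic_occ_def h_def)
    finally show "multiplicity_nu b w A * of_bool (cyclic_occ B r A) = (\<Prod>t<w. f t (A ! t))"
      by (simp add: f_def prod.distrib multiplicity_nu_eq_prod[OF A])
  qed
  also have "\<dots> = (\<Prod>t<w. \<Sum>c\<in>{0..b}. f t c)" by (rule sum_lists_prod) simp
  also have "\<dots> = (\<Prod>t<w. if t \<in> h ` {..<?k} then 1 else 2 ^ b)"
  proof (rule prod.cong[OF refl])
    fix t assume "t \<in> {..<w}"
    show "(\<Sum>c\<in>{0..b}. f t c) = (if t \<in> h ` {..<?k} then 1 else 2 ^ b)"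
    proof (cases "t \<in> h ` {..<?k}")
      case True
      then obtain j where j: "j < ?k" "h j = t" by auto
      have Bj: "B ! j < b" using B j nth_mem by blast
      have "i = j" if "i < ?k" "h i = t" for i using inj_onD[OF inj, of i j] that j by simp
      then have "(\<forall>i<?k. h i = t \<longrightarrow> c = B ! i) \<longleftrightarrow> c = B ! j" for c using j by blast
      then have "f t c = (if c = B ! j then 1 else 0)" for c using Bj by (simp add: f_def)
      then show ?thesis using True Bj by simp
    next
      case False
      then have "f t c = (if c = b then 2 ^ b - b else 1)" for c by (auto simp: f_def)
      moreover have "(\<Sum>c\<in>{0..b}. if c = b then 2 ^ b - b else 1) = (2 ^ b - b) + b"
      proof -
        have "{0..b} = insert b {..<b}" by auto
        then show ?thesis by simp
      qed
      moreover have "b \<le> 2 ^ b" by (simp add: less_imp_le)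
      ultimately show ?thesis using False by simp
    qed
  qed
  also have "\<dots> = (2 ^ b) ^ card ({..<w} - h ` {..<?k})"
    by (simp add: prod.If_cases Diff_eq)
  also have "card ({..<w} - h ` {..<?k}) = w - ?k"
    using inj hw by (subst card_Diff_subset) (auto simp: card_image)
  finally show ?thesis by (simp add: power_mult)
qed

text \<open>The list before flattening keeps the word boundaries of \<open>P_block\<close>
  visible.\<close>

definition P_words :: "nat \<Rightarrow> nat \<Rightarrow> block list" where
  "P_words b w = concat (map (\<lambda>A. replicate (multiplicity_nu b w A) A) (lex_blocks b w))"

lemma P_block_eq_concat: "P_block b w = concat (P_words b w)"
proof -
  have "concat (map (\<lambda>A. concat (replicate (m A) A)) As) = concat (concat (map (\<lambda>A. replicate (m A) A) As))"
    for m :: "block \<Rightarrow> nat" and As by (induction As) auto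
  then show ?thesis by (simp add: P_block_def P_words_def)
qed

lemma set_P_words: "set (P_words b w) \<subseteq> set (lex_blocks b w)"
  by (auto simp: P_words_def)

lemma length_word: "A \<in> set (P_words b w) \<Longrightarrow> length A = w"
  using set_P_words[of b w] by (auto simp: set_lex_blocks)

lemma distinct_lex_blocks: "distinct (lex_blocks b w)"
proof -
  have irr: "(A, A) \<notin> lexord {(c::nat, d). c < d}" for A
    by (rule lexord_irreflexive) simp
  have "distinct As" if "sorted_wrt (\<lambda>A B. (A, B) \<in> lexord {(c::nat, d). c < d}) As" for As
    using that by (induction As) (use irr in auto)
  then show ?thesis using sorted_lex_blocks by blast
qed

lemma length_lex_blocks: "length (lex_blocks b w) = Suc b ^ w"
proof -
  have "length (lex_blocks b w) = card {A. set A \<subseteq> {0..b} \<and> length A = w}"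
    using distinct_card[OF distinct_lex_blocks] by (simp add: set_lex_blocks conj_commute)
  then show ?thesis by (simp add: card_lists_length_eq)
qed

lemma sum_P_words:
  fixes F :: "block \<Rightarrow> nat"
  shows "(\<Sum>d<length (P_words b w). F (P_words b w ! d))
    = (\<Sum>A\<in>set (lex_blocks b w). multiplicity_nu b w A * F A)"
proof -
  have "(\<Sum>A\<leftarrow>concat (map (\<lambda>A. replicate (m A) A) As). F A) = (\<Sum>A\<leftarrow>As. m A * F A)"
    for m :: "block \<Rightarrow> nat" and As
    by (induction As) (auto simp: sum_list_replicate)
  then have "(\<Sum>A\<leftarrow>P_words b w. F A) = (\<Sum>A\<leftarrow>lex_blocks b w. multiplicity_nu b w A * F A)"
    by (simp add: P_words_def)
  then show ?thesis
    unfolding sum_list_distinct_conv_sum_set[OF distinct_lex_blocks]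
    by (simp add: sum_list_sum_nth atLeast0LessThan)
qed

lemma sum_P_words_cyclic_occ:
  assumes "length B \<le> w" "set B \<subseteq> {..<b}"
  shows "(\<Sum>d<length (P_words b w). of_bool (cyclic_occ B r (P_words b w ! d)))
     = (2 ^ (b * (w - length B)) :: nat)"
  using sum_P_words[where F = "\<lambda>A. of_bool (cyclic_occ B r A)"] sum_multiplicity_cyclic_occ[OF assms]
  by metis

text \<open>The empty block occurs cyclically in every word, so its count is the number of
  words.\<close>

lemma length_P_words: "length (P_words b w) = 2 ^ (b * w)"
  using sum_P_words_cyclic_occ[of "[]" w b 0] by (simp add: cyclic_occ_def)

lemma length_P_block: "length (P_block b w) = 2 ^ (b * w) * w"
  by (simp add: P_block_eq_concat length_word concat_uniform(1)[of _ w] length_P_words)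

lemma set_P_block: "set (P_block b w) \<subseteq> {0..b}"
  using set_P_words[of b w] by (fastforce simp: P_block_eq_concat set_lex_blocks)

text \<open>The last index counts as a change: what follows the list is unknown.\<close>

definition change_indices :: "'a list \<Rightarrow> nat set" where
  "change_indices D = {d. d < length D \<and> \<not> (Suc d < length D \<and> D ! Suc d = D ! d)}"

lemma finite_change_indices [simp]: "finite (change_indices D)"
  by (simp add: change_indices_def)

text \<open>Inside a run of equal words only the last index can be a change, so each entry of
  \<open>As\<close> accounts for at most one.\<close>

lemma card_change_indices:
  "card (change_indices (concat (map (\<lambda>A. replicate (m A) A) As))) \<le> length As"
proof (induction As)
  case Nil
  then show ?case by (simp add: change_indices_def)
next
  case (Cons A As)
  let ?D = "concat (map (\<lambda>A. replicate (m A) A) As)"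
  have "change_indices (replicate (m A) A @ ?D) \<subseteq> insert (m A - 1) ((+) (m A) ` change_indices ?D)"
  proof
    fix d assume d: "d \<in> change_indices (replicate (m A) A @ ?D)"
    consider "Suc d < m A" | "Suc d = m A" | "m A \<le> d" by linarith
    then show "d \<in> insert (m A - 1) ((+) (m A) ` change_indices ?D)"
    proof cases
      case 1
      then show ?thesis using d by (simp add: change_indices_def nth_append)
    next
      case 2
      then have "d = m A - 1" by simp
      then show ?thesis by blast
    next
      case 3
      then obtain e where "d = m A + e" using le_iff_add by blast
      then show ?thesis using d by (auto simp: change_indices_def nth_append image_iff)
    qed
  qed
  then have "card (change_indices (replicate (m A) A @ ?D))
      \<le> card (insert (m A - 1) ((+) (m A) ` change_indices ?D))"
    by (intro card_mono) auto
  also have "\<dots> \<le> Suc (card ((+) (m A) ` change_indices ?D))"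
    by (simp add: card_insert_if)
  also have "\<dots> \<le> Suc (card (change_indices ?D))" by (simp add: card_image_le)
  finally show ?case using Cons by simp
qed

text \<open>The sequence \<open>e\<close> continues beyond the block in an arbitrary way. True and
  cyclic occurrences agree at every offset of a word followed by its own copy; each change index
  spoils at most \<open>w\<close> offsets.\<close>

lemma occ_count_P_block:
  fixes e :: "nat \<Rightarrow> nat"
  assumes B: "length B \<le> w" "set B \<subseteq> {..<b}"
    and e: "\<And>t. t < length (P_block b w) \<Longrightarrow> e t = P_block b w ! t"
  shows "\<bar>(\<Sum>t<length (P_block b w). of_bool (\<forall>j<length B. e (t + j) = B ! j))
      - real (w * 2 ^ (b * (w - length B)))\<bar> \<le> real (w * Suc b ^ w)"
proof -
  let ?D = "P_words b w" and ?n = "length (P_words b w)"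
  define g :: "nat \<Rightarrow> real" where "g t = of_bool (\<forall>j<length B. e (t + j) = B ! j)" for t
  define c :: "nat \<Rightarrow> nat \<Rightarrow> real" where "c d r = of_bool (cyclic_occ B r (?D ! d))" for d r
  have len: "length (?D ! d) = w" if "d < ?n" for d using that length_word[of _ b w] by simp
  have eD: "e (d * w + r) = ?D ! d ! r" if "d < ?n" "r < w" for d r
  proof -
    have "d * w + r < Suc d * w" using that by simp
    also have "\<dots> \<le> ?n * w" using that by (intro mult_le_mono1) simp
    finally show ?thesis
      using that e[of "d * w + r"] concat_uniform[of ?D w] length_word by (simp add: P_block_eq_concat)
  qed
  \<comment> \<open>Since \<open>length B\<close> is at most \<open>w\<close>, an occurrence
    starting in word \<open>d\<close> ends no later than word \<open>d + 1\<close>, which here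
    equals word \<open>d\<close>.\<close>
  have good: "g (d * w + r) = c d r" if d: "d < ?n" "d \<notin> change_indices ?D" and r: "r < w" for d r
  proof -
    have d': "Suc d < ?n" "?D ! Suc d = ?D ! d" using d by (auto simp: change_indices_def)
    have "e (d * w + r + j) = ?D ! d ! ((r + j) mod w)" if "j < length B" for j
    proof (cases "r + j < w")
      case True
      then show ?thesis using eD[of d "r + j"] d by (simp add: add.assoc)
    next
      case False
      then have "(r + j) mod w = r + j - w" "r + j - w < w"
        using that r B by (simp_all add: mod_if)
      moreover have "d * w + r + j = Suc d * w + (r + j - w)" using False by simp
      ultimately show ?thesis using eD[of "Suc d" "r + j - w"] d' by (simp add: add.assoc)
    qed
    then show ?thesis using len[OF d(1)] by (simp add: g_def c_def cyclic_occ_def)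
  qed
  have 1: "(\<Sum>t<length (P_block b w). g t) = (\<Sum>d<?n. \<Sum>r<w. g (d * w + r))"
  proof -
    have "(\<Sum>d<?n. \<Sum>r<w. g (d * w + r)) = (\<Sum>d<?n. sum g {d * w..<d * w + w})"
    proof (rule sum.cong[OF refl])
      show "(\<Sum>r<w. g (d * w + r)) = sum g {d * w..<d * w + w}" for d
        using sum.shift_bounds_nat_ivl[of g 0 "d * w" w] by (simp add: add.commute atLeast0LessThan)
    qed
    also have "\<dots> = (\<Sum>t<?n * w. g t)" by (rule sum.nat_group)
    finally show ?thesis by (simp add: length_P_block length_P_words)
  qed
  have 2: "(\<Sum>d<?n. \<Sum>r<w. c d r) = real (w * 2 ^ (b * (w - length B)))"
  proof -
    have "(\<Sum>d<?n. c d r) = 2 ^ (b * (w - length B))" for r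
      using arg_cong[OF sum_P_words_cyclic_occ[OF B, of r], of real] by (simp add: c_def)
    then show ?thesis by (subst sum.swap) simp
  qed
  have "\<bar>(\<Sum>d<?n. \<Sum>r<w. g (d * w + r)) - (\<Sum>d<?n. \<Sum>r<w. c d r)\<bar>
      \<le> (\<Sum>d<?n. \<bar>\<Sum>r<w. g (d * w + r) - c d r\<bar>)"
    unfolding sum_subtractf[symmetric] by (rule sum_abs)
  also have "\<dots> \<le> (\<Sum>d<?n. if d \<in> change_indices ?D then real w else 0)"
  proof (rule sum_mono)
    fix d assume d: "d \<in> {..<?n}"
    have "\<bar>\<Sum>r<w. g (d * w + r) - c d r\<bar> \<le> (\<Sum>r<w. \<bar>g (d * w + r) - c d r\<bar>)" by (rule sum_abs)
    also have "\<dots> \<le> (\<Sum>r<w. if d \<in> change_indices ?D then 1 else 0)"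
      using good d by (intro sum_mono) (auto simp: g_def c_def of_bool_def)
    finally show "\<bar>\<Sum>r<w. g (d * w + r) - c d r\<bar> \<le> (if d \<in> change_indices ?D then real w else 0)"
      by (simp split: if_splits)
  qed
  also have "\<dots> = real (w * card (change_indices ?D))"
  proof -
    have "{..<?n} \<inter> change_indices ?D = change_indices ?D" by (auto simp: change_indices_def)
    then show ?thesis by (simp add: sum.If_cases Int_def[symmetric])
  qed
  also have "\<dots> \<le> real (w * Suc b ^ w)"
    using card_change_indices[of "multiplicity_nu b w" "lex_blocks b w"]
    by (intro of_nat_mono mult_le_mono2) (simp add: P_words_def length_lex_blocks)
  finally show ?thesis unfolding 1[symmetric] 2 by (simp add: g_def)
qed

section \<open>Comparison of partial sums cell by cell\<close>

lemma sum_atLeast1_add: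
  fixes h :: "nat \<Rightarrow> 'a::comm_monoid_add"
  shows "(\<Sum>s=1..n+m. h s) = (\<Sum>s=1..n. h s) + (\<Sum>t<m. h (Suc (n + t)))"
  by (induction m) (simp_all add: add.assoc)

text \<open>Group \<open>i\<close> consists of \<open>cnt i\<close> cells of length
  \<open>len i\<close> after position \<open>L i\<close>. Relative errors on whole cells add up to a
  relative error of the total, and an incomplete last cell costs at most its length because all
  terms lie in [0,1].\<close>

lemma ratio_tendsto_1_by_cells:
  fixes f g :: "nat \<Rightarrow> real" and L len cnt :: "nat \<Rightarrow> nat"
  defines "F \<equiv> \<lambda>n. \<Sum>s=1..n. f s" and "G \<equiv> \<lambda>n. \<Sum>s=1..n. g s"
  assumes f: "\<And>s. 0 \<le> f s" "\<And>s. f s \<le> 1" and g: "\<And>s. 0 \<le> g s" "\<And>s. g s \<le> 1"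
    and L: "\<And>i. L (Suc i) = L i + cnt i * len i"
    and pos: "\<forall>\<^sub>F i in sequentially. 0 < cnt i * len i"
    and cell: "\<And>\<epsilon>. 0 < \<epsilon> \<Longrightarrow> \<forall>\<^sub>F i in sequentially. \<forall>c<cnt i.
        \<bar>(\<Sum>t<len i. f (Suc (L i + c * len i + t))) - (\<Sum>t<len i. g (Suc (L i + c * len i + t)))\<bar>
          \<le> \<epsilon> * (\<Sum>t<len i. g (Suc (L i + c * len i + t)))"
    and small: "\<And>\<epsilon>. 0 < \<epsilon> \<Longrightarrow> \<forall>\<^sub>F i in sequentially. real (len i) \<le> \<epsilon> * G (L i)"
  shows "(\<lambda>n. F n / G n) \<longlonglongrightarrow> 1"
proof -
  define D where "D n = F n - G n" for n
  have F_add: "F (n + m) = F n + (\<Sum>t<m. f (Suc (n + t)))"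
   and G_add: "G (n + m) = G n + (\<Sum>t<m. g (Suc (n + t)))" for n m
    by (simp_all only: F_def G_def sum_atLeast1_add)
  have G_mono: "G m \<le> G n" if "m \<le> n" for m n
    using that G_add[of m "n - m"] g by (simp add: sum_nonneg)
  have G_nonneg: "0 \<le> G n" for n by (simp add: G_def g sum_nonneg)
  have D_step: "\<bar>D (n + m)\<bar> \<le> \<bar>D n\<bar> + real m" for n m
  proof -
    have "D (n + m) = D n + (\<Sum>t<m. f (Suc (n + t)) - g (Suc (n + t)))"
      by (simp add: D_def F_add G_add sum_subtractf)
    moreover have "\<bar>\<Sum>t<m. f (Suc (n + t)) - g (Suc (n + t))\<bar> \<le> (\<Sum>t<m. 1)"
      by (rule order_trans[OF sum_abs sum_mono]) (use f g in \<open>smt (verit)\<close>)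
    ultimately show ?thesis by simp
  qed
  have L_mono: "L i \<le> L j" if "i \<le> j" for i j
    using that by (rule lift_Suc_mono_le[rotated]) (simp add: L)
  have L_unbounded: "\<exists>j. n < L j" for n
  proof -
    obtain N where N: "\<And>i. N \<le> i \<Longrightarrow> 0 < cnt i * len i"
      using pos by (auto simp: eventually_sequentially)
    have "n \<le> L (N + n)" for n
    proof (induction n)
      case (Suc n) then show ?case using N[of "N + n"] unfolding add_Suc_right L by linarith
    qed simp
    from this[of "Suc n"] show ?thesis using Suc_le_lessD by blast
  qed
  \<comment> \<open>A nonempty cell has length at least 1, so smallness with factor
    \<open>\<epsilon>\<close> forces \<open>G (L i)\<close> to be at least the reciprocal of
    \<open>\<epsilon>\<close>.\<close>
  have G_top: "filterlim G at_top sequentially"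
    unfolding filterlim_at_top
  proof
    fix Z :: real
    define \<epsilon> where "\<epsilon> = 1 / (\<bar>Z\<bar> + 1)"
    have "\<epsilon> > 0" by (simp add: \<epsilon>_def)
    then have "\<forall>\<^sub>F i in sequentially. real (len i) \<le> \<epsilon> * G (L i) \<and> 0 < cnt i * len i"
      using small pos by (simp add: eventually_conj)
    then obtain i where i: "real (len i) \<le> \<epsilon> * G (L i)" "0 < cnt i * len i"
      by (auto simp: eventually_sequentially)
    then have "1 \<le> \<epsilon> * G (L i)"
      by (cases "len i = 0") (auto intro: order_trans[of 1 "real (len i)"])
    then have "Z \<le> G (L i)" by (simp add: \<epsilon>_def field_simps)
    then show "\<forall>\<^sub>F n in sequentially. Z \<le> G n"
      unfolding eventually_sequentially using G_mono order_trans by blast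
  qed
  \<comment> \<open>One \<open>\<epsilon>\<close> is for the complete cells, one for the incomplete
    last cell, and one absorbs the constant error at \<open>L N\<close>, since \<open>G\<close>
    diverges.\<close>
  have main: "\<forall>\<^sub>F n in sequentially. \<bar>D n\<bar> \<le> 3 * \<epsilon> * G n" if \<epsilon>: "0 < \<epsilon>" for \<epsilon>
  proof -
    obtain N where
      cellN: "\<And>i c. N \<le> i \<Longrightarrow> c < cnt i \<Longrightarrow>
        \<bar>(\<Sum>t<len i. f (Suc (L i + c * len i + t))) - (\<Sum>t<len i. g (Suc (L i + c * len i + t)))\<bar>
          \<le> \<epsilon> * (\<Sum>t<len i. g (Suc (L i + c * len i + t)))"
      and smallN: "\<And>i. N \<le> i \<Longrightarrow> real (len i) \<le> \<epsilon> * G (L i)"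
      using eventually_conj[OF cell[OF \<epsilon>] small[OF \<epsilon>]] by (auto simp: eventually_sequentially)
    have in_group: "\<bar>D (L i + c * len i)\<bar> \<le> \<bar>D (L i)\<bar> + \<epsilon> * (G (L i + c * len i) - G (L i))"
      if "N \<le> i" "c \<le> cnt i" for i c
      using that(2)
    proof (induction c)
      case (Suc c)
      let ?f = "\<Sum>t<len i. f (Suc (L i + c * len i + t))" and ?g = "\<Sum>t<len i. g (Suc (L i + c * len i + t))"
      have eq: "L i + Suc c * len i = (L i + c * len i) + len i" by simp
      have "D (L i + Suc c * len i) = D (L i + c * len i) + (?f - ?g)"
        unfolding eq D_def F_add G_add[of "L i + c * len i"] by simp
      moreover have "G (L i + Suc c * len i) = G (L i + c * len i) + ?g"
        unfolding eq G_add[of "L i + c * len i"] by simp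
      moreover have "\<bar>?f - ?g\<bar> \<le> \<epsilon> * ?g" using cellN[OF that(1)] Suc.prems by simp
      ultimately show ?case using Suc by (simp add: algebra_simps)
    qed simp
    have at_L: "\<bar>D (L i)\<bar> \<le> \<bar>D (L N)\<bar> + \<epsilon> * (G (L i) - G (L N))" if "N \<le> i" for i
      using that
    proof (induction i rule: dec_induct)
      case (step i)
      then show ?case using in_group[of i "cnt i"] by (simp add: L algebra_simps)
    qed simp
    have bound: "\<bar>D n\<bar> \<le> \<bar>D (L N)\<bar> + 2 * \<epsilon> * G n" if n: "L N \<le> n" for n
    proof -
      \<comment> \<open>The first group end beyond \<open>n\<close> locates the group containing
        \<open>n\<close>; below, \<open>c\<close> counts the complete cells before \<open>n\<close>
        and \<open>t\<close> is the remainder.\<close>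
      define j where "j = (LEAST j. n < L j)"
      have j: "n < L j" unfolding j_def using L_unbounded by (rule LeastI_ex)
      have "N < j" using j n L_mono[of j N] by linarith
      then obtain i where i: "j = Suc i" "N \<le> i" by (cases j) auto
      have Li: "L i \<le> n" using not_less_Least[of i "\<lambda>j. n < L j"] i by (simp add: j_def)
      define c where "c = (n - L i) div len i"
      define t where "t = (n - L i) mod len i"
      have n_eq: "n = (L i + c * len i) + t" using Li by (simp add: c_def t_def)
      have "n - L i < cnt i * len i" using j Li i L by simp
      then have "len i > 0" "c < cnt i" by (auto simp: c_def less_mult_imp_div_less intro: gr0I)
      then have t: "t \<le> len i" by (simp add: t_def less_imp_le)
      have "\<bar>D n\<bar> \<le> \<bar>D (L i + c * len i)\<bar> + real (len i)"
        using D_step[of "L i + c * len i" t] t n_eq by simp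
      also have "\<dots> \<le> \<bar>D (L N)\<bar> + \<epsilon> * (G (L i + c * len i) - G (L N)) + \<epsilon> * G (L i)"
        using in_group[OF i(2), of c] \<open>c < cnt i\<close> at_L[OF i(2)] smallN[OF i(2)] by (simp add: algebra_simps)
      also have "\<dots> \<le> \<bar>D (L N)\<bar> + \<epsilon> * G n + \<epsilon> * G n"
        using \<epsilon> G_mono[of "L i + c * len i" n] G_mono[of "L i" n] Li n_eq G_nonneg[of "L N"]
        by (intro add_mono mult_left_mono) auto
      finally show ?thesis by simp
    qed
    have "\<forall>\<^sub>F n in sequentially. \<bar>D (L N)\<bar> / \<epsilon> \<le> G n"
      using G_top by (simp add: filterlim_at_top)
    moreover have "\<forall>\<^sub>F n in sequentially. L N \<le> n" by (rule eventually_ge_at_top)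
    ultimately show ?thesis
    proof eventually_elim
      case (elim n)
      then have "\<bar>D (L N)\<bar> \<le> \<epsilon> * G n" using \<epsilon> by (simp add: field_simps)
      then show ?case using bound[OF elim(2)] by simp
    qed
  qed
  show ?thesis
  proof (rule LIMSEQ_I)
    fix r :: real assume r: "0 < r"
    have "\<forall>\<^sub>F n in sequentially. \<bar>D n\<bar> \<le> 3 * (r / 6) * G n" using main[of "r / 6"] r by simp
    moreover have "\<forall>\<^sub>F n in sequentially. 1 \<le> G n" using G_top by (simp add: filterlim_at_top)
    ultimately have "\<forall>\<^sub>F n in sequentially. norm (F n / G n - 1) < r"
    proof eventually_elim
      case (elim n)
      have "F n / G n - 1 = D n / G n" using elim by (simp add: D_def field_simps)
      then have "norm (F n / G n - 1) = \<bar>D n\<bar> / G n" using elim by simp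
      also have "\<dots> \<le> r / 2" using elim by (simp add: field_simps)
      also have "\<dots> < r" using r by simp
      finally show ?case .
    qed
    then show "\<exists>no. \<forall>n\<ge>no. norm (F n / G n - 1) < r" by (simp add: eventually_sequentially)
  qed
qed

section \<open>The concatenated digit sequence\<close>

lemma assoc_L_Suc: "assoc_L l X (Suc i) = assoc_L l X i + l (Suc i) * length (X (Suc i))"
  by (simp add: assoc_L_def)

lemma assoc_L_mono: "i \<le> j \<Longrightarrow> assoc_L l X i \<le> assoc_L l X j"
  by (rule lift_Suc_mono_le[of "assoc_L l X"]) (simp_all add: assoc_L_Suc)

lemma assoc_index_eq:
  assumes n: "assoc_L l X i < n" "n \<le> assoc_L l X (Suc i)"
  shows "assoc_index l X n = Suc i"
  unfolding assoc_index_def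
proof (rule the_equality)
  show "1 \<le> Suc i \<and> assoc_L l X (Suc i - 1) < n \<and> n \<le> assoc_L l X (Suc i)" using n by simp
next
  fix j assume j: "1 \<le> j \<and> assoc_L l X (j - 1) < n \<and> n \<le> assoc_L l X j"
  have "\<not> j \<le> i" using assoc_L_mono[of j i l X] j n by linarith
  moreover have "\<not> Suc i \<le> j - 1" using assoc_L_mono[of "Suc i" "j - 1" l X] j n by linarith
  ultimately show "j = Suc i" by linarith
qed

lemma cell_position_less:
  assumes "c < l (Suc i)" "t < length (X (Suc i))"
  shows "assoc_L l X i + c * length (X (Suc i)) + t < assoc_L l X (Suc i)"
proof -
  have "c * length (X (Suc i)) + t < Suc c * length (X (Suc i))" using assms by simp
  also have "\<dots> \<le> l (Suc i) * length (X (Suc i))" using assms by (intro mult_le_mono1) simp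
  finally show ?thesis by (simp add: assoc_L_Suc)
qed

lemma assoc_index_cell:
  assumes "c < l (Suc i)" "t < length (X (Suc i))"
  shows "assoc_index l X (Suc (assoc_L l X i + c * length (X (Suc i)) + t)) = Suc i"
  using cell_position_less[of c l i t X] assms by (intro assoc_index_eq) auto

lemma length_assoc_prefix: "length (assoc_prefix l X i) = assoc_L l X i"
  by (induction i) (simp_all add: assoc_prefix_def assoc_L_def length_concat sum_list_replicate)

lemma assoc_E_cell:
  assumes "c < l (Suc i)" "t < length (X (Suc i))"
  shows "assoc_E l X (Suc (assoc_L l X i + c * length (X (Suc i)) + t)) = X (Suc i) ! t"
proof -
  have "assoc_prefix l X (Suc i) = assoc_prefix l X i @ concat (replicate (l (Suc i)) (X (Suc i)))"
    by (simp add: assoc_prefix_def)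
  then have "assoc_E l X (Suc (assoc_L l X i + c * length (X (Suc i)) + t))
      = concat (replicate (l (Suc i)) (X (Suc i))) ! (c * length (X (Suc i)) + t)"
    by (simp add: assoc_E_def assoc_index_cell[of c l i t X, OF assms] nth_append length_assoc_prefix)
  then show ?thesis
    using assms concat_uniform(2)[of "replicate (l (Suc i)) (X (Suc i))" "length (X (Suc i))" c t] by simp
qed

lemma exists_cell:
  assumes n: "1 \<le> n" "n \<le> assoc_L l X m"
  obtains i c t where "c < l (Suc i)" "t < length (X (Suc i))"
    "n = Suc (assoc_L l X i + c * length (X (Suc i)) + t)"
proof -
  \<comment> \<open>By minimality the preceding group ends before \<open>n\<close>, so empty groups
    are skipped automatically.\<close>
  define j where "j = (LEAST j. n \<le> assoc_L l X j)"
  have j: "n \<le> assoc_L l X j" unfolding j_def using n(2) by (rule LeastI)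
  moreover have "assoc_L l X 0 = 0" by (simp add: assoc_L_def)
  ultimately have "j \<noteq> 0" using n by (metis le_zero_eq not_one_le_zero)
  then obtain i where i: "j = Suc i" using not0_implies_Suc by blast
  have Li: "assoc_L l X i < n" using not_less_Least[of i "\<lambda>j. n \<le> assoc_L l X j"] i by (simp add: j_def)
  let ?len = "length (X (Suc i))"
  have lt: "n - 1 - assoc_L l X i < l (Suc i) * ?len" using j Li i by (simp add: assoc_L_Suc)
  then have pos: "?len > 0" by (metis mult_0_right not_gr_zero not_less_zero)
  show ?thesis
  proof (rule that)
    show "(n - 1 - assoc_L l X i) div ?len < l (Suc i)" using lt by (rule less_mult_imp_div_less)
    show "(n - 1 - assoc_L l X i) mod ?len < ?len" using pos by simp
    show "n = Suc (assoc_L l X i + (n - 1 - assoc_L l X i) div ?len * ?len + (n - 1 - assoc_L l X i) mod ?len)"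
      using Li by simp
  qed
qed

section \<open>Numerical bounds\<close>

text \<open>It makes the number of spoiled offsets at most \<open>2 ^ -b\<close> times the main term
  of the count. Squaring both sides and using \<open>(b + 1)^2 \<le> 2 ^ b\<close>, which fails at 5
  and holds from 6 on, reduces the claim to \<open>w + 2 \<le> 2 * (w - k)\<close>.\<close>

lemma Suc_power_bound:
  assumes b: "6 \<le> b" and w: "2 * (k + 1) \<le> w"
  shows "Suc b ^ w * 2 ^ b \<le> (2::nat) ^ (b * (w - k))"
proof -
  have sq: "(Suc b)\<^sup>2 \<le> 2 ^ b" using b
  proof (induction b rule: dec_induct)
    case (step n)
    have "(Suc (Suc n))\<^sup>2 \<le> 2 * (Suc n)\<^sup>2"
    proof -
      have "6 * n \<le> n * n" using step by simp
      moreover have "6 * 6 \<le> n * n" using step by (intro mult_le_mono) auto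
      ultimately show ?thesis by (simp add: power2_eq_square)
    qed
    then show ?case using step by simp
  qed simp
  have "(Suc b ^ w * 2 ^ b)\<^sup>2 = ((Suc b)\<^sup>2) ^ w * 2 ^ (b * 2)"
    by (simp add: power_mult_distrib power_mult[symmetric] mult.commute)
  also have "\<dots> \<le> (2 ^ b) ^ w * 2 ^ (b * 2)" using sq by (intro mult_le_mono1 power_mono) auto
  also have "\<dots> = 2 ^ (b * (w + 2))" by (simp only: power_mult[symmetric] power_add[symmetric] distrib_left)
  also have "\<dots> \<le> 2 ^ (b * ((w - k) * 2))"
    using w by (intro power_increasing mult_le_mono2) auto
  also have "\<dots> = (2 ^ (b * (w - k)))\<^sup>2" by (simp add: power_mult[symmetric] mult.assoc)
  finally show ?thesis by (rule power2_le_imp_le) simp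
qed

lemma eventually_div_power_le:
  fixes \<epsilon> a :: real
  assumes "0 < \<epsilon>"
  shows "\<forall>\<^sub>F i in sequentially. a / 2 ^ i \<le> \<epsilon>"
proof -
  have "(\<lambda>i. a * (1 / 2) ^ i) \<longlonglongrightarrow> a * 0" by (intro tendsto_mult_left LIMSEQ_power_zero) simp
  then have "\<forall>\<^sub>F i in sequentially. a * (1 / 2) ^ i < \<epsilon>" using assms by (auto dest: order_tendstoD)
  then show ?thesis by eventually_elim (simp add: power_divide)
qed

section \<open>The concrete sequences and their normality\<close>

locale normal_construction =
  fixes X :: "nat \<Rightarrow> block" and b l :: "nat \<Rightarrow> nat"
  assumes initial: "\<And>i. 1 \<le> i \<Longrightarrow> i \<le> 5 \<Longrightarrow> X i = [0, 1] \<and> b i = 2 \<and> l i = 0"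
    and main: "\<And>i. 6 \<le> i \<Longrightarrow> X i = P_block i (i\<^sup>2) \<and> b i = 2 ^ i \<and> l i = 2 ^ (4 * i\<^sup>2)"
begin

abbreviation "L \<equiv> assoc_L l X"
abbreviation "Q \<equiv> assoc_Q l b X"
abbreviation "E \<equiv> assoc_E l X"
text \<open>Group \<open>Suc i\<close> begins right after position \<open>L i\<close>; copies and
  letters are counted from 0, positions from 1.\<close>

abbreviation "pos i c t \<equiv> Suc (L i + c * length (X (Suc i)) + t)"

lemma nonempty_group: "c < l (Suc i) \<Longrightarrow> 5 \<le> i"
  using initial[of "Suc i"] by (cases "5 \<le> i") auto

lemma group_pos: "5 \<le> i \<Longrightarrow> 0 < l (Suc i) * length (X (Suc i))"
  using main[of "Suc i"] by (simp add: length_P_block)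

lemma L_unbounded: "n \<le> L (5 + n)"
proof (induction n)
  case (Suc n)
  then show ?case using group_pos[of "5 + n"] unfolding add_Suc_right assoc_L_Suc by linarith
qed simp

lemma position_cases:
  assumes "1 \<le> n"
  obtains i c t where "5 \<le> i" "c < l (Suc i)" "t < length (X (Suc i))" "n = pos i c t"
  using exists_cell[OF assms L_unbounded] nonempty_group by metis

lemma Q_cell: "c < l (Suc i) \<Longrightarrow> t < length (X (Suc i)) \<Longrightarrow> Q (pos i c t) = 2 ^ Suc i"
  using main[of "Suc i"] nonempty_group[of c i] assoc_index_cell[of c l i t X]
  by (simp add: assoc_Q_def del: power_Suc)

text \<open>Needed for windows that leave their cell: the later bases can only decrease the
  weight.\<close>

lemma Q_mono:
  assumes mn: "1 \<le> m" "m \<le> n"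
  shows "Q m \<le> Q n"
proof -
  obtain i c t where i: "c < l (Suc i)" "t < length (X (Suc i))" "m = pos i c t"
    using position_cases[OF mn(1)] by blast
  have "1 \<le> n" using mn by simp
  then obtain i' c' t' where i': "c' < l (Suc i')" "t' < length (X (Suc i'))" "n = pos i' c' t'"
    using position_cases by blast
  have "n \<le> L (Suc i')" using cell_position_less[of c' l i' t' X] i' by simp
  then have "\<not> Suc i' \<le> i" using i mn assoc_L_mono[of "Suc i'" i l X] by linarith
  then show ?thesis using Q_cell[of c i t] Q_cell[of c' i' t'] i i' by simp
qed

text \<open>In group \<open>Suc i\<close> the digits are at most \<open>Suc i\<close>, while the
  base is \<open>2 ^ Suc i\<close> and \<open>i\<close> is at least 5. Hence the concatenated digits
  really are the Cantor digits of \<open>x\<close>.\<close>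

lemma E_less:
  assumes "1 \<le> n"
  shows "E n < Q n - 1"
proof -
  obtain i c t where i: "5 \<le> i" "c < l (Suc i)" "t < length (X (Suc i))" "n = pos i c t"
    using position_cases[OF assms] by blast
  have "X (Suc i) ! t \<in> {0..Suc i}"
  proof -
    have "X (Suc i) = P_block (Suc i) ((Suc i)\<^sup>2)" using main[of "Suc i"] i(1) by simp
    then show ?thesis using set_P_block[of "Suc i" "(Suc i)\<^sup>2"] nth_mem[OF i(3)] by (metis subsetD)
  qed
  then have "E n \<le> Suc i" using i by (simp add: assoc_E_cell)
  moreover have "Q n = 2 * 2 ^ i" using i by (simp add: Q_cell)
  moreover have "i < 2 ^ i" by (rule less_exp)
  ultimately show ?thesis using i(1) by linarith
qed

lemma basic_Q: "basic_sequence Q"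
  unfolding basic_sequence_def using E_less by fastforce

lemma expansion: "cantor_expansion Q (assoc_x l b X) E"
  unfolding assoc_x_def by (rule cantor_expansion_suminf[OF basic_Q E_less])

text \<open>Summed over positions, \<open>occ\<close> yields the block count and
  \<open>weight\<close> the normalising sum, the form required by the comparison of cells.\<close>

definition occ :: "block \<Rightarrow> nat \<Rightarrow> real" where
  "occ B s = of_bool (\<forall>j<length B. E (s + j) = B ! j)"

definition weight :: "nat \<Rightarrow> nat \<Rightarrow> real" where
  "weight k s = 1 / real (\<Prod>j<k. Q (s + j))"

lemma block_count_eq: "real (block_count Q n B (assoc_x l b X)) = (\<Sum>s=1..n. occ B s)"
proof -
  have "{s \<in> {1..n}. \<forall>j<length B. cantor_digits Q (assoc_x l b X) (s + j) = B ! j}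
      = {1..n} \<inter> {s. \<forall>j<length B. E (s + j) = B ! j}"
    using cantor_digits_eq[OF basic_Q expansion] by auto
  then show ?thesis by (simp add: block_count_def occ_def Int_def)
qed

lemma weight_bounds: "0 \<le> weight k s" "weight k s \<le> 1"
proof -
  \<comment> \<open>With division by zero giving 0, the case \<open>n = 0\<close> is covered, so the
    bounds hold even at the meaningless position 0.\<close>
  have "0 \<le> 1 / real n \<and> 1 / real n \<le> 1" for n :: nat by (cases n) auto
  then show "0 \<le> weight k s" "weight k s \<le> 1" unfolding weight_def by blast+
qed

lemma weight_cell_le:
  assumes "c < l (Suc i)" "t < length (X (Suc i))"
  shows "weight k (pos i c t) \<le> 1 / 2 ^ (Suc i * k)"
proof -
  have "(\<Prod>j<k. 2 ^ Suc i) \<le> (\<Prod>j<k. Q (pos i c t + j))"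
    using Q_mono[of "pos i c t"] Q_cell[OF assms] by (intro prod_mono) auto
  then have "2 ^ (Suc i * k) \<le> (\<Prod>j<k. Q (pos i c t + j))" by (simp only: prod_constant card_lessThan power_mult)
  then have "(2::real) ^ (Suc i * k) \<le> real (\<Prod>j<k. Q (pos i c t + j))"
    using of_nat_mono by fastforce
  then show ?thesis unfolding weight_def by (intro divide_left_mono mult_pos_pos) (auto intro: less_le_trans[rotated])
qed

lemma weight_cell_eq:
  assumes "c < l (Suc i)" "t + k \<le> length (X (Suc i))"
  shows "weight k (pos i c t) = 1 / 2 ^ (Suc i * k)"
proof -
  have "Q (pos i c t + j) = 2 ^ Suc i" if "j < k" for j
    using Q_cell[of c i "t + j"] assms that by (simp add: add.assoc)
  then have "(\<Prod>j<k. Q (pos i c t + j)) = (\<Prod>j<k. 2 ^ Suc i)" by (intro prod.cong) auto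
  then have "(\<Prod>j<k. Q (pos i c t + j)) = 2 ^ (Suc i * k)"
    by (simp only: prod_constant card_lessThan power_mult)
  then show ?thesis unfolding weight_def by simp
qed

text \<open>Both sums are compared with \<open>T\<close>, the exact cyclic count. \<open>T\<close>
  is also the cell length divided by \<open>2 ^ (m * k)\<close>, the weight sum if every window saw
  only the base \<open>2 ^ m\<close>. The deviation of \<open>F\<close> comes from word changes,
  that of \<open>G\<close> from windows crossing the end of the cell; both are at most
  \<open>T / 2 ^ m\<close>.\<close>

lemma cell_estimates:
  fixes B :: block and i c :: nat
  defines "m \<equiv> Suc i" and "k \<equiv> length B"
  defines "w \<equiv> m\<^sup>2" and "T \<equiv> real (m\<^sup>2 * 2 ^ (m * (m\<^sup>2 - length B)))"
    and "F \<equiv> \<Sum>t<length (X (Suc i)). occ B (pos i c t)"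
    and "G \<equiv> \<Sum>t<length (X (Suc i)). weight (length B) (pos i c t)"
  assumes c: "c < l (Suc i)" and k: "length B + 2 \<le> i" and B: "set B \<subseteq> {..<i}"
  shows "T / 2 \<le> G" and "\<bar>F - G\<bar> \<le> 4 / 2 ^ m * G"
proof -
  have m6: "6 \<le> m" using nonempty_group[OF c] by (simp add: m_def)
  have km: "k + 2 \<le> m" using k by (simp add: k_def m_def)
  have "6 * m \<le> w" using m6 by (simp add: w_def power2_eq_square)
  then have w: "2 * (k + 1) \<le> w" and kw: "k \<le> w" using km by auto
  have X: "X (Suc i) = P_block m w" using main[of m] m6 by (simp add: m_def w_def)
  have len: "length (X (Suc i)) = 2 ^ (m * w) * w" by (simp add: X length_P_block)
  have T: "T = real (w * 2 ^ (m * (w - k)))" by (simp add: T_def w_def k_def)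
  have lenT: "real (length (X (Suc i))) / 2 ^ (m * k) = T"
  proof -
    have "(2::real) ^ (m * w) = 2 ^ (m * (w - k)) * 2 ^ (m * k)"
      using kw by (simp add: power_add[symmetric] distrib_left[symmetric])
    then show ?thesis by (simp add: len T)
  qed
  have FT: "\<bar>F - T\<bar> \<le> real (w * Suc m ^ w)"
  proof -
    have "set B \<subseteq> {..<m}" using B by (auto simp: m_def)
    moreover have "E (pos i c t) = P_block m w ! t" if "t < length (P_block m w)" for t
      using assoc_E_cell[of c l i t X] c that X by simp
    ultimately show ?thesis
      using occ_count_P_block[of B w m "\<lambda>t. E (pos i c t)"] kw
      by (simp add: F_def occ_def T X k_def add.assoc)
  qed
  have GT: "G \<le> T"
  proof -
    have "G \<le> (\<Sum>t<length (X (Suc i)). 1 / 2 ^ (m * k))"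
      unfolding G_def m_def k_def by (intro sum_mono weight_cell_le[OF c]) simp
    then show ?thesis by (simp add: lenT[symmetric])
  qed
  \<comment> \<open>Only the last \<open>k\<close> starting positions are discarded, since all
    earlier windows stay inside the cell; the discarded terms would contribute at most
    \<open>k / 2 ^ (m * k)\<close>.\<close>
  have TG: "T - real k \<le> G"
  proof -
    have "T - real k \<le> real (length (X (Suc i)) - k) / 2 ^ (m * k)"
    proof -
      have "real (length (X (Suc i))) - real k \<le> real (length (X (Suc i)) - k)" by linarith
      then have "(real (length (X (Suc i))) - real k) / 2 ^ (m * k) \<le> real (length (X (Suc i)) - k) / 2 ^ (m * k)"
        by (intro divide_right_mono) auto
      moreover have "real k / 2 ^ (m * k) \<le> real k"
        by (simp add: divide_le_eq mult_le_cancel_left1)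
      ultimately show ?thesis by (simp add: lenT[symmetric] diff_divide_distrib)
    qed
    also have "\<dots> = (\<Sum>t<length (X (Suc i)) - k. weight (length B) (pos i c t))"
      using weight_cell_eq[OF c, of _ k] by (simp add: k_def m_def)
    also have "\<dots> \<le> G" unfolding G_def
      by (intro sum_mono2) (auto simp: weight_bounds)
    finally show ?thesis .
  qed
  have err: "real (w * Suc m ^ w) \<le> T / 2 ^ m"
  proof -
    have "real (Suc m ^ w * 2 ^ m) \<le> real (2 ^ (m * (w - k)))"
      using Suc_power_bound[OF m6 w] by (rule of_nat_mono)
    then have "real w * real (Suc m ^ w * 2 ^ m) \<le> real w * real (2 ^ (m * (w - k)))"
      by (intro mult_left_mono) auto
    then show ?thesis by (simp add: T field_simps)
  qed
  have "k \<le> w * Suc m ^ w" using mult_le_mono[OF kw, of 1 "Suc m ^ w"] by simp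
  then have kT: "real k \<le> T / 2 ^ m" using err by linarith
  have T0: "0 \<le> T" by (simp add: T)
  have "(4::real) \<le> 2 ^ m" using power_increasing[of 2 m "2::real"] m6 by simp
  then have "T / 2 ^ m \<le> T / 4" using T0 by (intro divide_left_mono) auto
  then show half: "T / 2 \<le> G" using TG kT T0 by linarith
  \<comment> \<open>The two deviations give the factor 2; replacing \<open>T\<close> by
    \<open>2 * G\<close> doubles it to 4.\<close>
  have "\<bar>F - G\<bar> \<le> 2 * (T / 2 ^ m)" using FT GT TG kT err by linarith
  also have "\<dots> = 4 / 2 ^ m * (T / 2)" by simp
  also have "\<dots> \<le> 4 / 2 ^ m * G" using half by (intro mult_left_mono) auto
  finally show "\<bar>F - G\<bar> \<le> 4 / 2 ^ m * G" .
qed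

text \<open>Group \<open>i\<close> alone suffices: each of its \<open>l i\<close> copies carries
  weight at least \<open>T / 2\<close>. The exponent \<open>(i + 1)^3\<close> in the length of the
  next block exceeds \<open>i^3\<close> by about \<open>3 * i^2\<close>, so the
  \<open>4 * i^2\<close> in \<open>l i\<close> leaves a surplus of \<open>i^2\<close>, which pays
  for the linear terms, including the loss \<open>i * k\<close>.\<close>

lemma cell_length_small:
  assumes i: "k + 8 \<le> i"
  shows "real (length (X (Suc i))) \<le> 1 / 2 ^ i * (\<Sum>s=1..L i. weight k s)"
proof -
  obtain h where h: "i = Suc h" using i by (cases i) auto
  define T where "T = real (i\<^sup>2 * 2 ^ (i * (i\<^sup>2 - k)))"
  have part: "real c * (T / 2) \<le> (\<Sum>s=1..L h + c * length (X i). weight k s)" if "c \<le> l i" for c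
    using that
  proof (induction c)
    case 0
    then show ?case by (simp add: sum_nonneg weight_bounds)
  next
    case (Suc c)
    \<comment> \<open>The lower bound on weights depends on the block only through its length, so
      zeros serve as a sample block of length \<open>k\<close>.\<close>
    have "T / 2 \<le> (\<Sum>t<length (X i). weight k (pos h c t))"
      using cell_estimates(1)[of c h "replicate k 0"] Suc.prems i h
      by (simp add: T_def set_replicate_conv_if)
    moreover have "L h + Suc c * length (X i) = (L h + c * length (X i)) + length (X i)" by simp
    then have "(\<Sum>s=1..L h + Suc c * length (X i). weight k s)
        = (\<Sum>s=1..L h + c * length (X i). weight k s) + (\<Sum>t<length (X i). weight k (pos h c t))"
      by (simp only: sum_atLeast1_add h)
    ultimately show ?case using Suc by (simp add: algebra_simps)
  qed
  have "real (l i) * (T / 2) \<le> (\<Sum>s=1..L i. weight k s)"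
    using part[of "l i"] by (simp add: h assoc_L_Suc)
  moreover have "real (length (X (Suc i))) * 2 ^ i \<le> real (l i) * (T / 2)"
  proof -
    \<comment> \<open>On the left, 2 comes from \<open>(i + 1)^2 \<le> 4 * i^2\<close>,
      \<open>i\<close> from the factor \<open>2 ^ i\<close> to be gained, and 1 from the half in
      \<open>T / 2\<close>.\<close>
    have exps: "Suc i * (Suc i)\<^sup>2 + 2 + i + 1 \<le> 4 * i\<^sup>2 + i * (i\<^sup>2 - k)"
    proof -
      have "(k + 8) * i \<le> i * i" using i by (rule mult_le_mono1)
      moreover have "k \<le> i\<^sup>2" using i by (simp add: power2_eq_square trans_le_add1 le_trans[OF _ le_square])
      then have "i * (i\<^sup>2 - k) + i * k = i * (i * i)"
        by (simp add: distrib_left[symmetric] power2_eq_square)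
      moreover have "8 \<le> i" using i by simp
      ultimately show ?thesis by (simp add: power2_eq_square algebra_simps)
    qed
    have "(Suc i)\<^sup>2 \<le> (2 * i)\<^sup>2" using i by (intro power_mono) auto
    then have sq: "(Suc i)\<^sup>2 \<le> 2\<^sup>2 * i\<^sup>2" by (simp only: power_mult_distrib)
    have "length (X (Suc i)) * 2 ^ i * 2 = 2 ^ (Suc i * (Suc i)\<^sup>2) * (Suc i)\<^sup>2 * 2 ^ i * 2"
      using main[of "Suc i"] i by (simp add: length_P_block)
    also have "\<dots> \<le> 2 ^ (Suc i * (Suc i)\<^sup>2) * (2\<^sup>2 * i\<^sup>2) * 2 ^ i * 2"
      using sq by (intro mult_le_mono1 mult_le_mono2)
    also have "\<dots> = 2 ^ (Suc i * (Suc i)\<^sup>2 + 2 + i + 1) * i\<^sup>2"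
      by (simp only: power_add power_one_right mult_ac)
    also have "\<dots> \<le> 2 ^ (4 * i\<^sup>2 + i * (i\<^sup>2 - k)) * i\<^sup>2"
      using exps by (intro mult_le_mono1 power_increasing) auto
    also have "\<dots> = l i * (i\<^sup>2 * 2 ^ (i * (i\<^sup>2 - k)))"
      using main[of i] i by (simp add: power_add)
    finally have "real (length (X (Suc i)) * 2 ^ i * 2) \<le> real (l i * (i\<^sup>2 * 2 ^ (i * (i\<^sup>2 - k))))"
      by (rule of_nat_mono)
    then show ?thesis by (simp add: T_def)
  qed
  ultimately show ?thesis by (simp add: field_simps)
qed

lemma normal: "Q_normal Q (assoc_x l b X)"
  unfolding Q_normal_def
proof (intro conjI allI impI)
  show "basic_sequence Q" by (rule basic_Q)
  show "0 \<le> assoc_x l b X" "assoc_x l b X < 1"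
    by (rule cantor_expansion_bounds[OF basic_Q expansion])+
  fix k :: nat and B :: block
  assume k: "length B = k"
  have "(\<lambda>n. (\<Sum>s=1..n. occ B s) / (\<Sum>s=1..n. weight k s)) \<longlonglongrightarrow> 1"
  proof (rule ratio_tendsto_1_by_cells[where L = L and cnt = "\<lambda>i. l (Suc i)" and len = "\<lambda>i. length (X (Suc i))"])
    show "0 \<le> occ B s" "occ B s \<le> 1" for s by (simp_all add: occ_def)
    show "0 \<le> weight k s" "weight k s \<le> 1" for s by (rule weight_bounds)+
    show "L (Suc i) = L i + l (Suc i) * length (X (Suc i))" for i by (rule assoc_L_Suc)
    show "\<forall>\<^sub>F i in sequentially. 0 < l (Suc i) * length (X (Suc i))"
      using group_pos by (auto simp: eventually_sequentially)
  next
    fix \<epsilon> :: real assume \<epsilon>: "0 < \<epsilon>"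
    \<comment> \<open>The digits of the fixed block \<open>B\<close> are below \<open>i\<close> from
      \<open>M\<close> on, as the cell estimate requires.\<close>
    obtain M where M: "set B \<subseteq> {..<M}" using finite_nat_set_iff_bounded[of "set B"] by auto
    show "\<forall>\<^sub>F i in sequentially. \<forall>c<l (Suc i).
        \<bar>(\<Sum>t<length (X (Suc i)). occ B (pos i c t)) - (\<Sum>t<length (X (Suc i)). weight k (pos i c t))\<bar>
          \<le> \<epsilon> * (\<Sum>t<length (X (Suc i)). weight k (pos i c t))"
      \<comment> \<open>The constant 2 arises because the relative error
        \<open>4 / 2 ^ Suc i\<close> equals \<open>2 / 2 ^ i\<close>.\<close>
      using eventually_ge_at_top[of "max M (k + 2)"] eventually_div_power_le[OF \<epsilon>, of 2]
    proof eventually_elim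
      case (elim i)
      show ?case
      proof (intro allI impI)
        fix c assume c: "c < l (Suc i)"
        let ?G = "\<Sum>t<length (X (Suc i)). weight k (pos i c t)"
        have "\<bar>(\<Sum>t<length (X (Suc i)). occ B (pos i c t)) - ?G\<bar> \<le> 4 / 2 ^ Suc i * ?G"
          using cell_estimates(2)[OF c, of B] elim M k by fastforce
        also have "\<dots> \<le> \<epsilon> * ?G"
          using elim by (intro mult_right_mono sum_nonneg weight_bounds) simp
        finally show "\<bar>(\<Sum>t<length (X (Suc i)). occ B (pos i c t)) - ?G\<bar> \<le> \<epsilon> * ?G" .
      qed
    qed
    show "\<forall>\<^sub>F i in sequentially. real (length (X (Suc i))) \<le> \<epsilon> * (\<Sum>s=1..L i. weight k s)"
      using eventually_ge_at_top[of "k + 8"] eventually_div_power_le[OF \<epsilon>, of 1]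
    proof eventually_elim
      case (elim i)
      have "real (length (X (Suc i))) \<le> 1 / 2 ^ i * (\<Sum>s=1..L i. weight k s)"
        using elim(1) by (rule cell_length_small)
      also have "\<dots> \<le> \<epsilon> * (\<Sum>s=1..L i. weight k s)"
        using elim by (intro mult_right_mono sum_nonneg weight_bounds) simp
      finally show ?case .
    qed
  qed
  then show "(\<lambda>n. real (block_count Q n B (assoc_x l b X)) / Q_sum Q k n) \<longlonglongrightarrow> 1"
    by (simp only: block_count_eq Q_sum_def weight_def)
qed

end

theorem theorem3:
  fixes X :: "nat \<Rightarrow> block" and b l :: "nat \<Rightarrow> nat"
  assumes "\<And>i. 1 \<le> i \<Longrightarrow> i \<le> 5 \<Longrightarrow> X i = [0, 1] \<and> b i = 2 \<and> l i = 0"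
    and "\<And>i. 6 \<le> i \<Longrightarrow> X i = P_block i (i\<^sup>2) \<and> b i = 2 ^ i \<and> l i = 2 ^ (4 * i\<^sup>2)"
  shows "Q_normal (assoc_Q l b X) (assoc_x l b X)"
proof -
  interpret normal_construction X b l by unfold_locales (fact assms)+
  show ?thesis by (rule normal)
qed

end
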